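(* Let $(\mathcal{P},\leq,\Omega)$ be a poset with a flow and let $(\mathcal{Q},\leq)$ be a complete lattice. Then the interleaving distance $d_{\mathrm{I}}$ on the set $[\mathcal{P},\mathcal{Q}]$ of order-preserving maps $\mathcal{P}\to\mathcal{Q}$ is geodesic.
   Context: A (strict) flow on a poset $\mathcal{P}$ is a family $\Omega=\{\Omega_\varepsilon:\mathcal{P}\to\mathcal{P}\}_{\varepsilon\in[0,\infty)}$ of order-preserving maps such that $\Omega_s\leq\Omega_t$ pointwise for $s\leq t$, $\Omega_t\Omega_s=\Omega_{t+s}$ for all $s,t\in[0,\infty)$, and $\Omega_0=\mathrm{id}_{\mathcal{P}}$. Order-preserving maps $\mathbf{F},\mathbf{G}:\mathcal{P}\to\mathcal{Q}$ are $\varepsilon$-interleaved if $\mathbf{F}(p)\leq\mathbf{G}(\Omega_\varepsilon(p))$ and $\mathbf{G}(p)\leq\mathbf{F}(\Omega_\varepsilon(p))$ for all $p\in\mathcal{P}$; $d_{\mathrm{I}}(\mathbf{F},\mathbf{G})\in[0,\infty]$ is the infimum of all $\varepsilon\in[0,\infty)$ such that they are $\varepsilon$-interleaved ($\infty$ if there is none); it is an extended pseudometric. Geodesicity convention: for an extended pseudometric space $(M,d)$, a point $x$ is identified with its class $\{y:d(x,y)=0\}$. For $x,y\in M$ with $d(x,y)<\infty$, a path from $x$ to $y$ is a continuous map $g:[0,1]\to M$ with $g(0)=x$ and $g(1)=y$ (up to this identification, i.e. $d(g(0),x)=0=d(g(1),y)$). The path is geodesic if $d(g(s),g(t))=|s-t|\cdot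 d(x,y)$ for all $s,t\in[0,1]$. $(M,d)$ (or $d$) is geodesic if every pair of points at finite distance is joined by a geodesic path. *)

theory Defs
  imports "HOL-Analysis.Analysis"
begin

text \<open>The time parameter ranges over \<open>[0,\<infinity>)\<close>; the values of \<open>\<Omega>\<close> at negative reals are irrelevant.\<close>

definition flow :: "(real \<Rightarrow> 'p::order \<Rightarrow> 'p) \<Rightarrow> bool" where
  "flow \<Omega> \<longleftrightarrow>
     (\<forall>t\<ge>0. mono (\<Omega> t)) \<and>
     (\<forall>s t. 0 \<le> s \<longrightarrow> s \<le> t \<longrightarrow> (\<forall>p. \<Omega> s p \<le> \<Omega> t p)) \<and>
     (\<forall>s\<ge>0. \<forall>t\<ge>0. \<Omega> t \<circ> \<Omega> s = \<Omega> (t + s)) \<and>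
     \<Omega> 0 = id"

definition interleaved ::
  "(real \<Rightarrow> 'p::order \<Rightarrow> 'p) \<Rightarrow> real \<Rightarrow> ('p \<Rightarrow> 'q::order) \<Rightarrow> ('p \<Rightarrow> 'q) \<Rightarrow> bool" where
  "interleaved \<Omega> \<epsilon> F G \<longleftrightarrow> (\<forall>p. F p \<le> G (\<Omega> \<epsilon> p) \<and> G p \<le> F (\<Omega> \<epsilon> p))"

text \<open>The infimum of the empty set is \<open>\<infinity>\<close> in \<^typ>\<open>ennreal\<close>.\<close>

definition interleaving_dist ::
  "(real \<Rightarrow> 'p::order \<Rightarrow> 'p) \<Rightarrow> ('p \<Rightarrow> 'q::order) \<Rightarrow> ('p \<Rightarrow> 'q) \<Rightarrow> ennreal" where
  "interleaving_dist \<Omega> F G = (INF \<epsilon>\<in>{\<epsilon>. 0 \<le> \<epsilon> \<and> interleaved \<Omega> \<epsilon> F G}. ennreal \<epsilon>)"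

definition ext_pseudometric_on :: "'a set \<Rightarrow> ('a \<Rightarrow> 'a \<Rightarrow> ennreal) \<Rightarrow> bool" where
  "ext_pseudometric_on M d \<longleftrightarrow>
     (\<forall>x\<in>M. d x x = 0) \<and>
     (\<forall>x\<in>M. \<forall>y\<in>M. d x y = d y x) \<and>
     (\<forall>x\<in>M. \<forall>y\<in>M. \<forall>z\<in>M. d x z \<le> d x y + d y z)"

definition ext_pseudometric_topology :: "'a set \<Rightarrow> ('a \<Rightarrow> 'a \<Rightarrow> ennreal) \<Rightarrow> 'a topology" where
  "ext_pseudometric_topology M d =
     topology (\<lambda>U. U \<subseteq> M \<and> (\<forall>x\<in>U. \<exists>r>0. {y \<in> M. d x y < r} \<subseteq> U))"

text \<open>
  Points at distance zero are identified, so a path need only start and end at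
  distance zero from the prescribed endpoints.
\<close>

definition path_between ::
  "'a set \<Rightarrow> ('a \<Rightarrow> 'a \<Rightarrow> ennreal) \<Rightarrow> (real \<Rightarrow> 'a) \<Rightarrow> 'a \<Rightarrow> 'a \<Rightarrow> bool" where
  "path_between M d g x y \<longleftrightarrow>
     continuous_map (top_of_set {0..1}) (ext_pseudometric_topology M d) g \<and>
     d (g 0) x = 0 \<and> d (g 1) y = 0"

definition geodesic_path_between ::
  "'a set \<Rightarrow> ('a \<Rightarrow> 'a \<Rightarrow> ennreal) \<Rightarrow> (real \<Rightarrow> 'a) \<Rightarrow> 'a \<Rightarrow> 'a \<Rightarrow> bool" where
  "geodesic_path_between M d g x y \<longleftrightarrow>
     path_between M d g x y \<and>
     (\<forall>s\<in>{0..1}. \<forall>t\<in>{0..1}. d (g s) (g t) = ennreal \<bar>s - t\<bar> * d x y)"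

definition geodesic_on :: "'a set \<Rightarrow> ('a \<Rightarrow> 'a \<Rightarrow> ennreal) \<Rightarrow> bool" where
  "geodesic_on M d \<longleftrightarrow>
     (\<forall>x\<in>M. \<forall>y\<in>M. d x y < \<infinity> \<longrightarrow> (\<exists>g. geodesic_path_between M d g x y))"

lemma openin_ext_pseudometric_topology:
  "openin (ext_pseudometric_topology M d) U \<longleftrightarrow>
     U \<subseteq> M \<and> (\<forall>x\<in>U. \<exists>r>0. {y \<in> M. d x y < r} \<subseteq> U)"
proof -
  have "istopology (\<lambda>U. U \<subseteq> M \<and> (\<forall>x\<in>U. \<exists>r>0. {y \<in> M. d x y < r} \<subseteq> U))"
    unfolding istopology_def
  proof (intro conjI allI impI)
    fix S T assume S: "S \<subseteq> M \<and> (\<forall>x\<in>S. \<exists>r>0. {y \<in> M. d x y < r} \<subseteq> S)"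
      and T: "T \<subseteq> M \<and> (\<forall>x\<in>T. \<exists>r>0. {y \<in> M. d x y < r} \<subseteq> T)"
    show "S \<inter> T \<subseteq> M" using S by blast
    show "\<forall>x\<in>S \<inter> T. \<exists>r>0. {y \<in> M. d x y < r} \<subseteq> S \<inter> T"
    proof
      fix x assume "x \<in> S \<inter> T"
      then obtain a b where "a > 0" "{y \<in> M. d x y < a} \<subseteq> S" "b > 0" "{y \<in> M. d x y < b} \<subseteq> T"
        using S T by blast
      then have "min a b > 0" "{y \<in> M. d x y < min a b} \<subseteq> S \<inter> T" by auto
      then show "\<exists>r>0. {y \<in> M. d x y < r} \<subseteq> S \<inter> T" by blast
    qed
  next
    fix K assume K: "\<forall>S\<in>K. S \<subseteq> M \<and> (\<forall>x\<in>S. \<exists>r>0. {y \<in> M. d x y < r} \<subseteq> S)"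
    show "\<Union>K \<subseteq> M" using K by blast
    show "\<forall>x\<in>\<Union>K. \<exists>r>0. {y \<in> M. d x y < r} \<subseteq> \<Union>K"
    proof
      fix x assume "x \<in> \<Union>K"
      then obtain S r where "S \<in> K" "r > 0" "{y \<in> M. d x y < r} \<subseteq> S" using K by blast
      then show "\<exists>r>0. {y \<in> M. d x y < r} \<subseteq> \<Union>K" by blast
    qed
  qed
  then show ?thesis by (simp add: ext_pseudometric_topology_def topology_inverse')
qed

lemma topspace_ext_pseudometric_topology [simp]:
  "topspace (ext_pseudometric_topology M d) = M"
proof
  show "topspace (ext_pseudometric_topology M d) \<subseteq> M"
    using openin_topspace[of "ext_pseudometric_topology M d"]
    unfolding openin_ext_pseudometric_topology by (rule conjunct1)
  have "openin (ext_pseudometric_topology M d) M"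
    unfolding openin_ext_pseudometric_topology by (auto intro: exI[of _ 1])
  then show "M \<subseteq> topspace (ext_pseudometric_topology M d)" by (rule openin_subset)
qed

lemma ext_pseudometric_interleaving_dist:
  fixes \<Omega> :: "real \<Rightarrow> 'p::order \<Rightarrow> 'p"
  assumes \<Omega>: "flow \<Omega>"
  shows "ext_pseudometric_on {F :: 'p \<Rightarrow> 'q::order. mono F} (interleaving_dist \<Omega>)"
  unfolding ext_pseudometric_on_def
proof (intro conjI ballI)
  fix F :: "'p \<Rightarrow> 'q"
  have "interleaving_dist \<Omega> F F \<le> ennreal 0"
    unfolding interleaving_dist_def using \<Omega>
    by (intro INF_lower) (simp add: interleaved_def flow_def)
  then show "interleaving_dist \<Omega> F F = 0" by simp
next
  fix F G :: "'p \<Rightarrow> 'q"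
  show "interleaving_dist \<Omega> F G = interleaving_dist \<Omega> G F"
    by (simp add: interleaving_dist_def interleaved_def conj_commute)
next
  fix F G H :: "'p \<Rightarrow> 'q"
  have comp: "\<Omega> t (\<Omega> s p) = \<Omega> (t + s) p" if "0 \<le> t" "0 \<le> s" for s t p
  proof -
    have "\<Omega> t \<circ> \<Omega> s = \<Omega> (t + s)" using \<Omega> that unfolding flow_def by blast
    then show ?thesis by (metis comp_apply)
  qed
  have trans: "interleaved \<Omega> (a + b) F H"
    if a: "a \<ge> 0" "interleaved \<Omega> a F G" and b: "b \<ge> 0" "interleaved \<Omega> b G H" for a b
  proof -
    have "F p \<le> H (\<Omega> (a + b) p) \<and> H p \<le> F (\<Omega> (a + b) p)" for p
    proof
      have "F p \<le> G (\<Omega> a p)" "G (\<Omega> a p) \<le> H (\<Omega> b (\<Omega> a p))"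
        using a(2) b(2) by (auto simp: interleaved_def)
      moreover have "\<Omega> b (\<Omega> a p) = \<Omega> (a + b) p"
        using comp[OF b(1) a(1)] by (simp add: add.commute)
      ultimately show "F p \<le> H (\<Omega> (a + b) p)" by simp
      have "H p \<le> G (\<Omega> b p)" "G (\<Omega> b p) \<le> F (\<Omega> a (\<Omega> b p))"
        using a(2) b(2) by (auto simp: interleaved_def)
      then show "H p \<le> F (\<Omega> (a + b) p)"
        using comp[OF a(1) b(1)] by simp
    qed
    then show ?thesis by (simp add: interleaved_def)
  qed
  have le: "interleaving_dist \<Omega> F H \<le> ennreal a + ennreal b"
    if "a \<ge> 0" "interleaved \<Omega> a F G" "b \<ge> 0" "interleaved \<Omega> b G H" for a b
  proof -
    have "interleaving_dist \<Omega> F H \<le> ennreal (a + b)"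
      unfolding interleaving_dist_def using trans[OF that] that by (intro INF_lower) simp
    then show ?thesis using that by simp
  qed
  show "interleaving_dist \<Omega> F H \<le> interleaving_dist \<Omega> F G + interleaving_dist \<Omega> G H"
  proof (rule ennreal_le_epsilon)
    fix e :: real
    assume fin: "interleaving_dist \<Omega> F G + interleaving_dist \<Omega> G H < top" and e: "0 < e"
    have approx: "\<exists>c\<ge>0. interleaved \<Omega> c K L \<and>
        ennreal c \<le> interleaving_dist \<Omega> K L + ennreal (e / 2)"
      if "interleaving_dist \<Omega> K L < top" for K L :: "'p \<Rightarrow> 'q"
    proof -
      have "interleaving_dist \<Omega> K L < interleaving_dist \<Omega> K L + ennreal (e / 2)"
        using that e by (simp add: ennreal_add_left_cancel_less)
      then show ?thesis
        unfolding interleaving_dist_def[of \<Omega> K L] INF_less_iff by (blast dest: less_imp_le)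
    qed
    obtain a b where a: "a \<ge> 0" "interleaved \<Omega> a F G"
        "ennreal a \<le> interleaving_dist \<Omega> F G + ennreal (e / 2)"
      and b: "b \<ge> 0" "interleaved \<Omega> b G H"
        "ennreal b \<le> interleaving_dist \<Omega> G H + ennreal (e / 2)"
      using approx[of F G] approx[of G H] fin by auto
    have "interleaving_dist \<Omega> F H \<le> ennreal a + ennreal b"
      using le a b by blast
    also have "\<dots> \<le> (interleaving_dist \<Omega> F G + ennreal (e / 2)) +
        (interleaving_dist \<Omega> G H + ennreal (e / 2))"
      using a b by (intro add_mono)
    also have "\<dots> = interleaving_dist \<Omega> F G + interleaving_dist \<Omega> G H +
        (ennreal (e / 2) + ennreal (e / 2))"
      by (simp only: ac_simps)
    also have "ennreal (e / 2) + ennreal (e / 2) = ennreal e"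
      using e by (subst ennreal_plus[symmetric]) auto
    finally show "interleaving_dist \<Omega> F H \<le>
        interleaving_dist \<Omega> F G + interleaving_dist \<Omega> G H + ennreal e" .
  qed
qed

end

theory Submission
  imports Defs
begin

text \<open>
  Let \<open>D\<close> be the finite distance between \<open>F\<close> and \<open>G\<close>. In a complete lattice each order-preserving
  map \<open>F\<close> can be delayed along the flow: \<open>delay \<Omega> a F\<close> is the left Kan extension of \<open>F\<close> along
  \<open>\<Omega>\<^sub>a\<close>, which stands in for the meaningless \<open>F \<circ> \<Omega>\<^bsub>-a\<^esub>\<close>. The path is
  the join of \<open>F\<close> delayed by \<open>tD\<close> and \<open>G\<close> delayed by \<open>(1 - t)D\<close>, that is, the least
  order-preserving \<open>H\<close> with \<open>F \<le> H \<circ> \<Omega>\<^bsub>tD\<^esub>\<close> and \<open>G \<le> H \<circ> \<Omega>\<^bsub>(1-t)D\<^esub>\<close>.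

  Changing a delay by \<open>c\<close> is compensated by flowing for time \<open>c\<close>, so the path is \<open>D\<close>-Lipschitz.
  At \<open>t = 0\<close> the join consists of \<open>F\<close> itself and of \<open>G\<close> delayed by \<open>D\<close>. If \<open>D\<close> itself is an
  interleaving parameter, the second map lies below the first and the join is \<open>F\<close>. In general
  \<open>F\<close> and \<open>G\<close> are \<open>c\<close>-interleaved only for \<open>c\<close> arbitrarily close to \<open>D\<close>, and the overshoot \<open>c - D\<close>
  moves the join away from \<open>F\<close> by at most \<open>c - D\<close>; hence their distance is still \<open>0\<close>. The case
  \<open>t = 1\<close> is symmetric. Finally, a \<open>D\<close>-Lipschitz path between points at distance \<open>D\<close> has no slack
  in the triangle inequality, so it is geodesic.
\<close>

text \<open>
  For \<open>s \<le> t\<close>, the Lipschitz bounds on \<open>[0,s]\<close>, \<open>[s,t]\<close> and \<open>[t,1]\<close> add up to exactly \<open>d x y\<close>. If the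
  bound on \<open>[s,t]\<close> were not attained, the triangle inequality would make \<open>d x y\<close> smaller than itself.
\<close>

lemma geodesic_path_between_if_Lipschitz:
  fixes d :: "'a \<Rightarrow> 'a \<Rightarrow> ennreal"
  assumes d: "ext_pseudometric_on M d"
    and M: "x \<in> M" "y \<in> M" "\<And>t. t \<in> {0..1} \<Longrightarrow> g t \<in> M"
    and fin: "d x y < \<infinity>"
    and ends: "d (g 0) x = 0" "d (g 1) y = 0"
    and Lip: "\<And>s t. s \<in> {0..1} \<Longrightarrow> t \<in> {0..1} \<Longrightarrow> d (g s) (g t) \<le> ennreal \<bar>s - t\<bar> * d x y"
  shows "geodesic_path_between M d g x y"
proof -
  have sym: "d u v = d v u" if "u \<in> M" "v \<in> M" for u v
    using d that by (auto simp: ext_pseudometric_on_def)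
  have tri: "d u w \<le> d u v + d v w" if "u \<in> M" "v \<in> M" "w \<in> M" for u v w
    using d that by (auto simp: ext_pseudometric_on_def)
  obtain D where D: "D \<ge> 0" "d x y = ennreal D"
    using fin by (cases "d x y") auto
  have Lip': "d (g s) (g t) \<le> ennreal (\<bar>s - t\<bar> * D)" if "s \<in> {0..1}" "t \<in> {0..1}" for s t
    using Lip[OF that] D by (simp add: ennreal_mult)
  have cont: "continuous_map (top_of_set {0..1}) (ext_pseudometric_topology M d) g"
    unfolding continuous_map_alt topspace_ext_pseudometric_topology topspace_euclidean_subtopology
  proof (intro conjI allI impI)
    show "g \<in> {0..1} \<rightarrow> M" using M by auto
    fix U assume U: "openin (ext_pseudometric_topology M d) U"
    show "openin (top_of_set {0..1}) (g -` U \<inter> {0..1})"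
      unfolding openin_euclidean_subtopology_iff
    proof (intro conjI ballI)
      show "g -` U \<inter> {0..1} \<subseteq> {0..1}" by blast
      fix s assume s: "s \<in> g -` U \<inter> {0..1}"
      obtain r where r: "r > 0" "{z \<in> M. d (g s) z < r} \<subseteq> U"
        using U s unfolding openin_ext_pseudometric_topology by blast
      obtain r' where r': "r' > 0" "ennreal r' < r"
        using ennreal_rat_dense[OF r(1)] by (metis ennreal_less_zero_iff)
      (* D may be 0, hence the denominator D + 1. *)
      have "t \<in> g -` U \<inter> {0..1}" if t: "t \<in> {0..1}" "dist t s < r' / (D + 1)" for t
      proof -
        have "\<bar>s - t\<bar> * D \<le> \<bar>s - t\<bar> * (D + 1)" by (simp add: mult_left_mono)
        also have "\<dots> < r'"
          using t(2) D(1) by (simp add: dist_real_def abs_minus_commute pos_less_divide_eq)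
        finally have "d (g s) (g t) < r"
          using Lip'[of s t] s t r'(2)
          by (meson IntD2 ennreal_leI less_imp_le order_le_less_trans)
        then show ?thesis using r(2) t M(3) by auto
      qed
      moreover have "r' / (D + 1) > 0" using r' D by simp
      ultimately show "\<exists>e>0. \<forall>t\<in>{0..1}. dist t s < e \<longrightarrow> t \<in> g -` U \<inter> {0..1}" by blast
    qed
  qed
  have ge: "ennreal (\<bar>s - t\<bar> * D) \<le> d (g s) (g t)" if st: "s \<in> {0..1}" "t \<in> {0..1}" "s \<le> t" for s t
  proof -
    have g: "g 0 \<in> M" "g s \<in> M" "g t \<in> M" "g 1 \<in> M" using M st by auto
    have fin_st: "d (g s) (g t) < top"
      using Lip'[OF st(1,2)] by (simp add: order_le_less_trans)
    then obtain e where e: "e \<ge> 0" "d (g s) (g t) = ennreal e"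
      by (cases "d (g s) (g t)") auto
    have "ennreal D \<le> d x (g 0) + (d (g 0) (g s) + (d (g s) (g t) + (d (g t) (g 1) + d (g 1) y)))"
      unfolding D(2)[symmetric]
      using g M by (meson add_left_mono order_trans tri)
    also have "\<dots> = d (g 0) (g s) + (d (g s) (g t) + d (g t) (g 1))"
      using ends sym[of x "g 0"] g M by simp
    also have "\<dots> \<le> ennreal (s * D) + (ennreal e + ennreal ((1 - t) * D))"
      using Lip'[of 0 s] Lip'[of t 1] st e by (intro add_mono) auto
    also have "\<dots> = ennreal (s * D + (e + (1 - t) * D))"
      using st D e by (simp flip: ennreal_plus)
    finally have "D \<le> s * D + (e + (1 - t) * D)"
      using st D e by (subst (asm) ennreal_le_iff) auto
    then have "\<bar>s - t\<bar> * D \<le> e" using st by (simp add: algebra_simps)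
    then show ?thesis using e by (simp add: ennreal_leI)
  qed
  have "d (g s) (g t) = ennreal \<bar>s - t\<bar> * d x y" if st: "s \<in> {0..1}" "t \<in> {0..1}" for s t
  proof -
    have "ennreal (\<bar>s - t\<bar> * D) \<le> d (g s) (g t)"
    proof (cases "s \<le> t")
      case True
      then show ?thesis using ge st by blast
    next
      case False
      then show ?thesis using ge[of t s] st sym[of "g s" "g t"] M by (simp add: abs_minus_commute)
    qed
    with Lip'[OF st] show ?thesis using D by (simp add: ennreal_mult antisym)
  qed
  with cont ends show ?thesis
    unfolding geodesic_path_between_def path_between_def by blast
qed

text \<open>This is the pointwise formula for the left Kan extension of \<open>F\<close> along \<open>\<Omega>\<^sub>a\<close>.\<close>

definition delay :: "(real \<Rightarrow> 'p::order \<Rightarrow> 'p) \<Rightarrow> real \<Rightarrow> ('p \<Rightarrow> 'q::complete_lattice) \<Rightarrow> 'p \<Rightarrow> 'q" where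
  "delay \<Omega> a F p = (SUP q\<in>{q. \<Omega> a q \<le> p}. F q)"

lemma mono_delay: "mono (delay \<Omega> a F)"
  unfolding delay_def by (intro monoI SUP_subset_mono) auto

lemma flow_add:
  assumes "flow \<Omega>" "0 \<le> s" "0 \<le> t"
  shows "\<Omega> t (\<Omega> s p) = \<Omega> (t + s) p"
  using assms unfolding flow_def by (metis comp_apply)

lemma delay_zero:
  assumes "flow \<Omega>" "mono F"
  shows "delay \<Omega> 0 F = F"
proof
  fix p
  have "\<Omega> 0 = id" using assms by (simp add: flow_def)
  then show "delay \<Omega> 0 F p = F p"
    unfolding delay_def using assms(2) by (auto intro!: antisym SUP_least SUP_upper dest: monoD)
qed

text \<open>
  If \<open>\<Omega>\<^sub>a q\<close> lies below \<open>p\<close>, then flowing both for time \<open>c\<close> puts \<open>\<Omega>\<^bsub>a+c\<^esub> q\<close>, and hence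
  \<open>\<Omega>\<^bsub>a'\<^esub> q\<close>, below \<open>\<Omega>\<^sub>c p\<close>: every term of the first supremum occurs in the second.
\<close>

lemma delay_le_delay_shift:
  assumes \<Omega>: "flow \<Omega>" and "0 \<le> a" "0 \<le> a'" "0 \<le> c" "a' \<le> a + c"
  shows "delay \<Omega> a F p \<le> delay \<Omega> a' F (\<Omega> c p)"
  unfolding delay_def
proof (rule SUP_subset_mono[OF _ order_refl], safe)
  fix q assume "\<Omega> a q \<le> p"
  have "\<Omega> a' q \<le> \<Omega> (c + a) q" using assms by (simp add: flow_def)
  also have "\<dots> = \<Omega> c (\<Omega> a q)" using assms by (simp add: flow_add)
  also have "\<dots> \<le> \<Omega> c p" using \<open>\<Omega> a q \<le> p\<close> assms by (auto simp: flow_def dest: monoD)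
  finally show "\<Omega> a' q \<le> \<Omega> c p" .
qed

text \<open>
  One half of an interleaving with parameter \<open>c \<ge> a\<close>: a delay by \<open>a\<close> absorbs the part \<open>a\<close> of the
  shift, leaving \<open>c - a\<close>.
\<close>

lemma delay_le_shift:
  assumes \<Omega>: "flow \<Omega>" and F: "mono F" and ac: "0 \<le> a" "a \<le> c"
    and GF: "\<And>q. G q \<le> F (\<Omega> c q)"
  shows "delay \<Omega> a G p \<le> F (\<Omega> (c - a) p)"
  unfolding delay_def
proof (rule SUP_least, safe)
  fix q assume "\<Omega> a q \<le> p"
  have "G q \<le> F (\<Omega> (c - a) (\<Omega> a q))" using GF[of q] ac \<Omega> by (simp add: flow_add)
  also have "\<dots> \<le> F (\<Omega> (c - a) p)"
    using \<open>\<Omega> a q \<le> p\<close> \<Omega> ac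
    by (intro monoD[OF F] monoD[of "\<Omega> (c - a)"]) (auto simp: flow_def)
  finally show "G q \<le> F (\<Omega> (c - a) p)" .
qed

definition delayed_join ::
  "(real \<Rightarrow> 'p::order \<Rightarrow> 'p) \<Rightarrow> real \<Rightarrow> ('p \<Rightarrow> 'q::complete_lattice) \<Rightarrow> real \<Rightarrow> ('p \<Rightarrow> 'q) \<Rightarrow> 'p \<Rightarrow> 'q"
  where "delayed_join \<Omega> a F b G p = sup (delay \<Omega> a F p) (delay \<Omega> b G p)"

lemma mono_delayed_join: "mono (delayed_join \<Omega> a F b G)"
  unfolding delayed_join_def by (intro monoI sup_mono) (auto intro: monoD[OF mono_delay])

lemma delayed_join_commute: "delayed_join \<Omega> a F b G = delayed_join \<Omega> b G a F"
  by (simp add: delayed_join_def sup_commute fun_eq_iff)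

lemma interleaving_dist_le:
  assumes "0 \<le> c" "interleaved \<Omega> c F G"
  shows "interleaving_dist \<Omega> F G \<le> ennreal c"
  unfolding interleaving_dist_def using assms by (intro INF_lower) simp

lemma interleaving_dist_commute: "interleaving_dist \<Omega> F G = interleaving_dist \<Omega> G F"
  by (simp add: interleaving_dist_def interleaved_def conj_commute)

lemma interleaving_dist_delayed_join_le:
  assumes "flow \<Omega>" "0 \<le> a" "0 \<le> a'" "0 \<le> b" "0 \<le> b'" "\<bar>a - a'\<bar> \<le> c" "\<bar>b - b'\<bar> \<le> c"
  shows "interleaving_dist \<Omega> (delayed_join \<Omega> a F b G) (delayed_join \<Omega> a' F b' G) \<le> ennreal c"
  using assms unfolding delayed_join_def
  by (intro interleaving_dist_le)
    (auto simp: interleaved_def simp del: le_sup_iff sup.bounded_iff intro!: sup_mono delay_le_delay_shift)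

text \<open>
  Every parameter \<open>c \<ge> D\<close> for which \<open>F\<close> and \<open>G\<close> are interleaved gives a \<open>(c - D)\<close>-interleaving of
  the join with \<open>F\<close>, and \<open>D\<close>, being the infimum of such \<open>c\<close>, is approached by them.
\<close>

lemma interleaving_dist_delayed_join_zero:
  assumes \<Omega>: "flow \<Omega>" and F: "mono F" and D: "0 \<le> D" "interleaving_dist \<Omega> F G = ennreal D"
  shows "interleaving_dist \<Omega> (delayed_join \<Omega> 0 F D G) F = 0"
proof -
  have "interleaving_dist \<Omega> (delayed_join \<Omega> 0 F D G) F \<le> 0 + ennreal e" if "e > 0" for e
  proof -
    have "interleaving_dist \<Omega> F G < ennreal (D + e)"
      using D that by (simp add: ennreal_less_iff)
    then obtain c where c: "0 \<le> c" "interleaved \<Omega> c F G" "ennreal c < ennreal (D + e)"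
      unfolding interleaving_dist_def INF_less_iff by blast
    have "D \<le> c"
      using interleaving_dist_le[OF c(1,2)] D c(1) by simp
    have incr: "F p \<le> F (\<Omega> (c - D) p)" for p
    proof -
      have "\<Omega> 0 p \<le> \<Omega> (c - D) p" using \<Omega> \<open>D \<le> c\<close> unfolding flow_def by force
      moreover have "\<Omega> 0 p = p" using \<Omega> by (simp add: flow_def)
      ultimately show ?thesis using F by (simp add: monoD)
    qed
    have "interleaved \<Omega> (c - D) (delayed_join \<Omega> 0 F D G) F"
      unfolding interleaved_def delayed_join_def delay_zero[OF \<Omega> F]
      using incr c(2) \<open>D \<le> c\<close> \<Omega> F D(1)
      by (auto intro: le_supI1 delay_le_shift simp: interleaved_def)
    then have "interleaving_dist \<Omega> (delayed_join \<Omega> 0 F D G) F \<le> ennreal (c - D)"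
      using \<open>D \<le> c\<close> by (intro interleaving_dist_le) auto
    also have "\<dots> \<le> ennreal e" using c D by (intro ennreal_leI) (simp add: ennreal_less_iff)
    finally show ?thesis by simp
  qed
  then have "interleaving_dist \<Omega> (delayed_join \<Omega> 0 F D G) F \<le> 0"
    by (rule ennreal_le_epsilon)
  then show ?thesis by simp
qed

theorem theorem3p13:
  fixes \<Omega> :: "real \<Rightarrow> 'p::order \<Rightarrow> 'p"
  assumes "flow \<Omega>"
  shows "geodesic_on {F :: 'p \<Rightarrow> 'q::complete_lattice. mono F} (interleaving_dist \<Omega>)"
  unfolding geodesic_on_def
proof (intro ballI impI)
  fix F G :: "'p \<Rightarrow> 'q"
  assume "F \<in> {F. mono F}" "G \<in> {F. mono F}" and fin: "interleaving_dist \<Omega> F G < \<infinity>"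
  then have FG: "mono F" "mono G" by auto
  obtain D where D: "0 \<le> D" "interleaving_dist \<Omega> F G = ennreal D"
    using fin by (cases "interleaving_dist \<Omega> F G") auto
  define H where "H t = delayed_join \<Omega> (t * D) F ((1 - t) * D) G" for t
  have "geodesic_path_between {F. mono F} (interleaving_dist \<Omega>) H F G"
  proof (rule geodesic_path_between_if_Lipschitz)
    show "ext_pseudometric_on {F :: 'p \<Rightarrow> 'q. mono F} (interleaving_dist \<Omega>)"
      using assms by (rule ext_pseudometric_interleaving_dist)
    show "H t \<in> {F. mono F}" for t
      by (simp add: H_def mono_delayed_join)
    show "interleaving_dist \<Omega> (H 0) F = 0"
      using interleaving_dist_delayed_join_zero[OF assms FG(1) D] by (simp add: H_def)
    show "interleaving_dist \<Omega> (H 1) G = 0"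
      using interleaving_dist_delayed_join_zero[OF assms FG(2) D(1), of F] D(2)
      by (simp add: H_def delayed_join_commute[of _ _ F] interleaving_dist_commute[of _ G F])
    fix s t :: real assume st: "s \<in> {0..1}" "t \<in> {0..1}"
    have "interleaving_dist \<Omega> (H s) (H t) \<le> ennreal (\<bar>s - t\<bar> * D)"
      unfolding H_def using assms st D(1)
      by (intro interleaving_dist_delayed_join_le)
        (auto simp: abs_mult left_diff_distrib[symmetric] abs_minus_commute)
    then show "interleaving_dist \<Omega> (H s) (H t) \<le> ennreal \<bar>s - t\<bar> * interleaving_dist \<Omega> F G"
      using D by (simp add: ennreal_mult)
  qed (use FG fin in auto)
  then show "\<exists>g. geodesic_path_between {F. mono F} (interleaving_dist \<Omega>) g F G" by blast
qed

end
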